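(* There is an absolute constant $c>0$ such that for every positive integer $n$ there exists an ordered graph with $n$ vertices and at least $c\,n\,\alpha(n)$ edges that does not contain $H_1$ as an ordered subgraph, where $\alpha(n)$ is the inverse Ackermann function.
   Context: An ordered graph is a graph with a linear order on its vertices. $H_1$ is the ordered graph on vertices $a<b<c<d<e$ with edges $(a,e),(b,d),(c,e)$. An ordered graph $G$ contains $H_1$ as an ordered subgraph if there is an order-preserving injection from the vertices of $H_1$ to the vertices of $G$ mapping every edge of $H_1$ to an edge of $G$. *)

theory Defs
  imports Complex_Main
begin

fun ack :: "nat \<Rightarrow> nat \<Rightarrow> nat" where
  "ack 0 m = Suc m"
| "ack (Suc k) 0 = ack k 1"
| "ack (Suc k) (Suc m) = ack k (ack (Suc k) m)"

definition inv_ack :: "nat \<Rightarrow> nat" where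
  "inv_ack n = (LEAST k. ack k k \<ge> n)"

text \<open>An ordered graph on n vertices: vertex set {0..<n} with the natural order;
  an edge {i,j} with i<j is represented by the pair (i,j).\<close>
definition ordered_graph :: "nat \<Rightarrow> (nat \<times> nat) set \<Rightarrow> bool" where
  "ordered_graph n E \<longleftrightarrow> E \<subseteq> {(i, j). i < j \<and> j < n}"

text \<open>G contains H1 (vertices a<b<c<d<e, edges ae, bd, ce) as an ordered subgraph:
  an order-preserving injection is exactly a choice of a<b<c<d<e.\<close>
definition contains_H1 :: "(nat \<times> nat) set \<Rightarrow> bool" where
  "contains_H1 E \<longleftrightarrow> (\<exists>a b c d e. a < b \<and> b < c \<and> c < d \<and> d < e \<and>
      (a, e) \<in> E \<and> (b, d) \<in> E \<and> (c, e) \<in> E)"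

end

theory Submission
  imports Defs "HOL-Library.Infinite_Set"
begin

text \<open>The construction is modelled on the one for Davenport--Schinzel sequences of order 3. The
  graph \<open>G(k, m)\<close> has special vertices with exactly \<open>m\<close> neighbours each, and every right endpoint
  of an edge has \<open>k\<close> left neighbours, the first of which is special. If \<open>A = G(k, m)\<close> has \<open>b\<close>
  special vertices, then \<open>G(k, m + 1)\<close> arises from \<open>G(k - 1, b)\<close> by inserting a copy of \<open>A\<close> directly
  before each special vertex \<open>p\<close> and joining the \<open>i\<close>-th special vertex of the copy to the \<open>i\<close>-th
  neighbour of \<open>p\<close>; only the special vertices of the copies are special in the new graph. The
  right endpoints in the outer graph gain one neighbour each, the order of the new edges excludes
  copies of \<open>H\<^sub>1\<close>, and the number of special vertices obeys an Ackermann recursion. As \<open>G(k, 1)\<close>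
  with \<open>s\<close> special vertices has at most \<open>3 s\<close> vertices and \<open>k s\<close> edges, disjoint unions of its
  copies suffice.\<close>

section \<open>Growth of the Ackermann function\<close>

lemma ack_gt: "m < ack k m"
proof (induction k m rule: ack.induct)
  case (3 k m)
  then show ?case by simp
qed auto

lemma ack_less_Suc: "ack k m < ack k (Suc m)"
  by (cases k) (auto simp: ack_gt)

lemma ack_strict_mono: "m < m' \<Longrightarrow> ack k m < ack k m'"
  using lift_Suc_mono_less[of "ack k"] ack_less_Suc by blast

lemma ack_mono: "m \<le> m' \<Longrightarrow> ack k m \<le> ack k m'"
  using ack_strict_mono[of m m' k] by (cases "m = m'") auto

text \<open>By the recursion, the step only needs \<open>Suc (Suc m) \<le> ack (Suc k) m\<close>,
  which follows from the induction hypothesis and \<open>ack_gt\<close>. Trading a unit of the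
  argument for a level then gives monotonicity in the level.\<close>

lemma ack_Suc_le: "ack k (Suc m) \<le> ack (Suc k) m"
proof (induction m)
  case (Suc m)
  have "Suc (Suc m) \<le> ack k (Suc m)" using ack_gt[of "Suc m" k] by simp
  with Suc have "Suc (Suc m) \<le> ack (Suc k) m" by linarith
  then show ?case by (simp add: ack_mono)
qed simp

lemma ack_mono_left: "k \<le> k' \<Longrightarrow> ack k m \<le> ack k' m"
proof (induction rule: dec_induct)
  case (step n)
  have "ack n m \<le> ack n (Suc m)" by (simp add: ack_mono)
  with step ack_Suc_le[of n m] show ?case by linarith
qed simp

lemma ack_1: "ack (Suc 0) m = m + 2"
  by (induction m) auto

lemma ack_2: "ack (Suc (Suc 0)) m = 2 * m + 3"
  by (induction m) (auto simp: ack_1)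

lemma ack_3_Suc: "ack 3 (Suc m) = 2 * ack 3 m + 3"
  by (simp add: numeral_3_eq_3 ack_2)

lemma ack_3_0: "ack 3 0 = 5"
  by (simp add: numeral_3_eq_3 ack_2)

text \<open>Level 3 grows exponentially, so one application absorbs the product in the recursion of
  \<open>special_count\<close>.\<close>

lemma ack_3_ge_square: "m * m + 1 \<le> ack 3 m"
proof (induction m)
  case (Suc m)
  have "0 \<le> (int m - 1)\<^sup>2" by simp
  then have "int (2 * m) \<le> int (m * m + 1)"
    by (simp add: power2_eq_square algebra_simps)
  then have "2 * m \<le> m * m + 1" by linarith
  with Suc show ?case by (simp add: ack_3_Suc)
qed (simp add: ack_3_0)

lemma ack_3_ge_triple: "3 * m \<le> ack 3 m"
  by (induction m) (auto simp: ack_3_Suc ack_3_0)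

text \<open>\<open>special_count k m\<close> belongs to level \<open>k + 1\<close>, that is, to \<open>G(k + 1, m)\<close>.\<close>

fun special_count :: "nat \<Rightarrow> nat \<Rightarrow> nat" where
  "special_count 0 m = 2"
| "special_count (Suc k) 0 = 2"
| "special_count (Suc k) (Suc m) =
     special_count k (special_count (Suc k) m) * special_count (Suc k) m"

lemma special_count_pos: "special_count k m > 0"
  by (induction k m rule: special_count.induct) auto

text \<open>One level of \<open>special_count\<close> costs two Ackermann levels: the first absorbs
  the lower level followed by a multiplication, the second the iteration over
  \<open>m\<close>.\<close>

lemma special_count_less_ack: "special_count k m < ack (2 * k + 3) (Suc m)"
proof (induction k m rule: special_count.induct)
  case (1 m)
  show ?case using ack_3_ge_triple[of "Suc m"] by simp
next
  case (2 k)
  have "ack 3 1 \<le> ack (2 * Suc k + 3) 1" by (rule ack_mono_left) simp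
  with ack_3_ge_triple[of 1] show ?case by simp
next
  case (3 k m)
  define b where "b = special_count (Suc k) m"
  define j where "j = 2 * k + 3"
  define p where "p = ack j (Suc b)"
  have j: "2 * Suc k + 3 = Suc (Suc j)" by (simp add: j_def)
  have b: "b < ack (Suc (Suc j)) (Suc m)"
    using 3(1) unfolding b_def j .
  have s: "special_count k b < p" "b < p"
    using 3(2) ack_gt[of "Suc b" j] by (simp_all add: b_def p_def j_def)
  have "special_count k b * b < p * p + 1"
    using s mult_mono[of "special_count k b" p b p] by simp
  also have "\<dots> \<le> ack 3 p" by (rule ack_3_ge_square)
  also have "\<dots> \<le> ack j p" by (rule ack_mono_left) (simp add: j_def)
  also have "\<dots> \<le> ack j (ack (Suc j) b)"
    unfolding p_def by (intro ack_mono ack_Suc_le)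
  also have "\<dots> = ack (Suc j) (Suc b)" by (rule ack.simps(3)[symmetric])
  also have "\<dots> \<le> ack (Suc j) (ack (Suc (Suc j)) (Suc m))"
    using b by (intro ack_mono) simp
  also have "\<dots> = ack (2 * Suc k + 3) (Suc (Suc m))"
    unfolding j by (rule ack.simps(3)[symmetric])
  finally show ?case by (simp only: b_def special_count.simps)
qed

text \<open>The factor 3 bounds the vertices per special vertex when each has one neighbour; the
  diagonal value is what \<open>inv_ack\<close> compares with.\<close>

lemma triple_special_count_le_ack: "3 * special_count k 1 \<le> ack (2 * k + 4) (2 * k + 4)"
proof -
  define j where "j = 2 * k + 3"
  have j: "3 \<le> j" "2 * k + 4 = Suc j" by (simp_all add: j_def)
  have "special_count k 1 < ack j (Suc 1)"
    unfolding j_def by (rule special_count_less_ack)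
  then have "3 * special_count k 1 \<le> 3 * ack j (Suc 1)" by linarith
  also have "\<dots> \<le> ack 3 (ack j (Suc 1))" by (rule ack_3_ge_triple)
  also have "\<dots> \<le> ack j (ack j (Suc 1))" using j(1) by (rule ack_mono_left)
  also have "\<dots> \<le> ack j (ack (Suc j) 1)" by (intro ack_mono ack_Suc_le)
  also have "\<dots> = ack (Suc j) (Suc 1)" by (rule ack.simps(3)[symmetric])
  also have "\<dots> \<le> ack (Suc j) (Suc j)" using j(1) by (intro ack_mono) linarith
  finally show ?thesis unfolding j(2) .
qed

section \<open>Layered ordered graphs\<close>

text \<open>\<open>P\<close> is the set of special vertices. The condition ending in \<open>d \<le> c\<close> rules out the copies of
  \<open>H\<^sub>1\<close> that a substitution would otherwise create by splitting \<open>p\<close> into the first two vertices.\<close>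

definition layered :: "nat \<Rightarrow> nat \<Rightarrow> nat set \<Rightarrow> nat set \<Rightarrow> (nat \<times> nat) set \<Rightarrow> bool" where
  "layered k m V P E \<longleftrightarrow>
     finite V \<and> P \<subseteq> V \<and> E \<subseteq> {(i, j). i \<in> V \<and> j \<in> V \<and> i < j} \<and>
     \<not> contains_H1 E \<and>
     (\<forall>p\<in>P. \<forall>a. (a, p) \<notin> E) \<and>
     (\<forall>p\<in>P. card (E `` {p}) = m) \<and>
     (\<forall>p a e. p \<in> P \<and> (p, e) \<in> E \<and> (a, e) \<in> E \<longrightarrow> p \<le> a) \<and>
     (\<forall>p c d e. p \<in> P \<and> (p, d) \<in> E \<and> (p, e) \<in> E \<and> (c, e) \<in> E \<and> d < e \<and> p < c \<longrightarrow> d \<le> c) \<and>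
     card E = k * m * card P \<and>
     card V + 2 \<le> (m + 2) * card P"

text \<open>A right endpoint has a single left neighbour here, which makes the conditions on two
  edges with a common right end trivial. One star would violate the vertex bound with its slack of
  2; two stars attain it.\<close>

lemma layered_two_stars: "\<exists>V P E. layered 1 m V P E \<and> card P = 2"
proof -
  define V where "V = {..<2 * m + 2}"
  define P where "P = {0, Suc m}"
  define E where "E = Pair 0 ` {1..m} \<union> Pair (Suc m) ` {m + 2..2 * m + 1}"
  have img: "E `` {0} = {1..m}" "E `` {Suc m} = {m + 2..2 * m + 1}"
    by (auto simp: E_def)
  have "card E = card (Pair (0::nat) ` {1..m}) + card (Pair (Suc m) ` {m + 2..2 * m + 1})"
    unfolding E_def by (rule card_Un_disjoint) auto
  then have card_E: "card E = 2 * m"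
    by (simp add: card_image inj_on_def)
  have unique: "a = c" if "(a, e) \<in> E" "(c, e) \<in> E" for a c e
    using that by (auto simp: E_def)
  have "layered 1 m V P E"
    unfolding layered_def
  proof (intro conjI)
    show "\<not> contains_H1 E"
      unfolding contains_H1_def by (metis less_trans order_less_irrefl unique)
    show "\<forall>p\<in>P. card (E `` {p}) = m"
      using img by (auto simp: P_def)
    show "\<forall>p a e. p \<in> P \<and> (p, e) \<in> E \<and> (a, e) \<in> E \<longrightarrow> p \<le> a"
      by (metis order_refl unique)
    show "\<forall>p c d e. p \<in> P \<and> (p, d) \<in> E \<and> (p, e) \<in> E \<and> (c, e) \<in> E \<and> d < e \<and> p < c \<longrightarrow> d \<le> c"
      by (metis order_less_irrefl unique)
  qed (auto simp: V_def P_def card_E, auto simp: E_def)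
  moreover have "card P = 2" by (simp add: P_def)
  ultimately show ?thesis by blast
qed

lemma layered_no_edges: "\<exists>V P E. layered k 0 V P E \<and> card P = 2"
  by (rule exI[of _ "{0, 1}"], rule exI[of _ "{0, 1}"], rule exI[of _ "{}"])
    (simp add: layered_def contains_H1_def)

lemma ex_strict_mono_bij:
  fixes A B :: "nat set"
  assumes "finite A" "finite B" "card A = card B"
  shows "\<exists>h. bij_betw h A B \<and> strict_mono_on A h"
proof -
  obtain f where f: "bij_betw f {..<card A} A" "strict_mono_on {..<card A} f"
    using ex_bij_betw_strict_mono_card assms(1) by blast
  obtain g where g: "bij_betw g {..<card A} B" "strict_mono_on {..<card A} g"
    using ex_bij_betw_strict_mono_card assms by metis
  define f' where "f' = inv_into {..<card A} f"
  have f': "bij_betw f' A {..<card A}"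
    unfolding f'_def by (rule bij_betw_inv_into[OF f(1)])
  have mono: "f' x < f' y" if "x \<in> A" "y \<in> A" "x < y" for x y
  proof (rule ccontr)
    assume "\<not> f' x < f' y"
    moreover have "f' x < card A" "f' y < card A" using f' that by (auto simp: bij_betw_def)
    ultimately have "f (f' y) \<le> f (f' x)"
      using f(2) by (auto simp: strict_mono_on_def le_less not_less)
    moreover have "f (f' x) = x" "f (f' y) = y"
      using that f(1) by (simp_all add: f'_def bij_betw_inv_into_right)
    ultimately show False using that by simp
  qed
  have "strict_mono_on A (g \<circ> f')"
    using g(2) mono bij_betw_apply[OF f'] by (simp add: strict_mono_on_def)
  moreover have "bij_betw (g \<circ> f') A B"
    by (rule bij_betw_trans[OF f' g(1)])
  ultimately show ?thesis by blast
qed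

section \<open>Substitution\<close>

text \<open>Digits in base \<open>Suc w\<close> realise the lexicographic order of pairs inside the
  natural numbers.\<close>

lemma lex_code_less_iff:
  fixes q q' r r' w :: nat
  assumes "r \<le> w" "r' \<le> w"
  shows "q * Suc w + r < q' * Suc w + r' \<longleftrightarrow> q < q' \<or> q = q' \<and> r < r'"
proof -
  have "x * Suc w + a < y * Suc w + b" if "x < y" "a \<le> w" for x y a b :: nat
  proof -
    have "Suc x * Suc w \<le> y * Suc w" using that by (intro mult_le_mono1) simp
    then show ?thesis using that by simp
  qed
  from this[of q q' r r'] this[of q' q r' r] assms show ?thesis
    by (cases q q' rule: linorder_cases) auto
qed

lemma lex_code_eq_iff:
  fixes q q' r r' w :: nat
  assumes "r \<le> w" "r' \<le> w"
  shows "q * Suc w + r = q' * Suc w + r' \<longleftrightarrow> q = q' \<and> r = r'"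
  using lex_code_less_iff[OF assms, of q q'] lex_code_less_iff[OF assms(2,1), of q' q]
  by (metis linorder_neq_iff)

text \<open>In the new graph, \<open>q * Suc w + r\<close> is the vertex \<open>r\<close> of the copy in front of \<open>q\<close> if \<open>r < w\<close>,
  and the outer vertex \<open>q\<close> if \<open>r = w\<close>.\<close>

lemma layered_substitute:
  assumes inner: "layered (Suc k) m V P E" and outer: "layered k (card P) V' P' E'"
  shows "\<exists>V'' P'' E''. layered (Suc k) (Suc m) V'' P'' E'' \<and> card P'' = card P' * card P"
proof -
  note i = inner[unfolded layered_def] and o = outer[unfolded layered_def]
  have fin: "finite V" "finite P" "finite E" "finite V'" "finite P'" "finite E'"
  proof -
    show "finite V" "finite V'" using i o by auto
    then show "finite P" "finite P'" using i o finite_subset by auto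
    have "E \<subseteq> V \<times> V" "E' \<subseteq> V' \<times> V'" using i o by auto
    then show "finite E" "finite E'"
      using \<open>finite V\<close> \<open>finite V'\<close> by (meson finite_SigmaI finite_subset)+
  qed
  obtain w where w: "\<And>x. x \<in> V \<Longrightarrow> x < w"
    using fin(1) finite_nat_set_iff_bounded by auto
  \<comment> \<open>A special outer vertex has exactly \<open>card P\<close> neighbours, so they can
    be matched in order with the special vertices of its copy.\<close>
  have "\<exists>h. bij_betw h P (E' `` {p}) \<and> strict_mono_on P h" if "p \<in> P'" for p
    using that o fin by (intro ex_strict_mono_bij) (auto simp: finite_Image)
  then obtain h where h: "\<And>p. p \<in> P' \<Longrightarrow> bij_betw (h p) P (E' `` {p})"
    "\<And>p. p \<in> P' \<Longrightarrow> strict_mono_on P (h p)"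
    by metis
  have h_edge: "(p, h p x) \<in> E'" if "p \<in> P'" "x \<in> P" for p x
    using h(1)[OF that(1)] that(2) by (auto simp: bij_betw_def)
  have h_inj: "h p x = h p y \<longleftrightarrow> x = y" if "p \<in> P'" "x \<in> P" "y \<in> P" for p x y
    using h(1)[OF that(1)] that by (auto simp: bij_betw_def inj_on_def)
  have h_less: "h p x < h p y \<longleftrightarrow> x < y" if "p \<in> P'" "x \<in> P" "y \<in> P" for p x y
    using h(2)[OF that(1)] that by (meson strict_mono_on_less)
  define enc where "enc q r = q * Suc w + r" for q r
  have enc_less: "enc q r < enc q' r' \<longleftrightarrow> q < q' \<or> q = q' \<and> r < r'"
    if "r \<le> w" "r' \<le> w" for q r q' r'
    unfolding enc_def by (rule lex_code_less_iff[OF that])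
  have enc_eq: "enc q r = enc q' r' \<longleftrightarrow> q = q' \<and> r = r'" if "r \<le> w" "r' \<le> w" for q r q' r'
    unfolding enc_def by (rule lex_code_eq_iff[OF that])
  have P_w: "x < w" if "x \<in> P" for x using that w i by auto
  have E_w: "x < y" "x < w" "y < w" if "(x, y) \<in> E" for x y using that w i by auto
  have E'_less: "x < y" "x \<in> V'" "y \<in> V'" if "(x, y) \<in> E'" for x y using that o by auto

  \<comment> \<open>The suffixes mark outer parts (\<open>o\<close>), inner copies
    (\<open>i\<close>) and linking edges (\<open>l\<close>).\<close>
  define Vo where "Vo = (\<lambda>v. enc v w) ` V'"
  define Vi where "Vi = (\<lambda>(p, x). enc p x) ` (P' \<times> V)"
  define P'' where "P'' = (\<lambda>(p, x). enc p x) ` (P' \<times> P)"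
  define Eo where "Eo = (\<lambda>(u, v). (enc u w, enc v w)) ` E'"
  define Ei where "Ei = (\<lambda>(p, x, y). (enc p x, enc p y)) ` (P' \<times> E)"
  define El where "El = (\<lambda>(p, x). (enc p x, enc (h p x) w)) ` (P' \<times> P)"
  define E'' where "E'' = Eo \<union> Ei \<union> El"

  have card_P'': "card P'' = card P' * card P"
    unfolding P''_def by (subst card_image) (auto simp: inj_on_def enc_eq P_w less_imp_le card_cartesian_product)
  have card_V'': "card (Vo \<union> Vi) = card V' + card P' * card V"
  proof -
    have "card Vo = card V'" unfolding Vo_def
      by (subst card_image) (auto simp: inj_on_def enc_eq)
    moreover have "card Vi = card P' * card V" unfolding Vi_def
      by (subst card_image) (auto simp: inj_on_def enc_eq w less_imp_le card_cartesian_product)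
    moreover have "Vo \<inter> Vi = {}"
      by (auto simp: Vo_def Vi_def enc_eq less_imp_le w dest: w)
    moreover have "finite Vo" "finite Vi" using fin by (auto simp: Vo_def Vi_def)
    ultimately show ?thesis by (simp add: card_Un_disjoint)
  qed
  \<comment> \<open>The second digit separates the three families: it is \<open>w\<close> at both
    ends in \<open>Eo\<close>, at neither end in \<open>Ei\<close>, and only at the right end in
    \<open>El\<close>.\<close>
  have card_E'': "card E'' = card E' + card P' * card E + card P' * card P"
  proof -
    have "card Eo = card E'" unfolding Eo_def
      by (subst card_image) (auto simp: inj_on_def enc_eq)
    moreover have "card Ei = card P' * card E" unfolding Ei_def
      by (subst card_image) (auto simp: inj_on_def enc_eq E_w less_imp_le card_cartesian_product)
    moreover have "card El = card P' * card P" unfolding El_def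
      by (subst card_image) (auto simp: inj_on_def enc_eq P_w less_imp_le card_cartesian_product)
    moreover have "Eo \<inter> Ei = {}"
      by (auto simp: Eo_def Ei_def enc_eq less_imp_le E_w dest: E_w)
    moreover have "(Eo \<union> Ei) \<inter> El = {}"
      by (auto simp: Eo_def Ei_def El_def enc_eq less_imp_le E_w P_w dest: E_w P_w)
    moreover have "finite Eo" "finite Ei" "finite El"
      using fin by (auto simp: Eo_def Ei_def El_def)
    ultimately show ?thesis by (simp add: E''_def card_Un_disjoint)
  qed

  \<comment> \<open>An edge that ends in a copy stays in it. Any other edge becomes an outer edge
    when each copy is contracted to the vertex behind it.\<close>
  have edge_to_inner: "\<exists>x. u = enc p x \<and> p \<in> P' \<and> (x, y) \<in> E"
    if "(u, enc p y) \<in> E''" "y < w" for u p y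
    using that by (auto simp: E''_def Eo_def Ei_def El_def enc_eq less_imp_le E_w)
  have edge_to_outer: "\<exists>u x. s = enc u x \<and> x \<le> w \<and> (u, v) \<in> E' \<and>
      (x = w \<or> u \<in> P' \<and> x \<in> P \<and> v = h u x)"
    if "(s, enc v w) \<in> E''" for s v
    using that P_w h_edge
    by (fastforce simp: E''_def Eo_def Ei_def El_def enc_eq less_imp_le dest: E_w)
  have edge_end: "(\<exists>v. t = enc v w) \<or> (\<exists>p y. t = enc p y \<and> y < w)" if "(s, t) \<in> E''" for s t
    using that by (auto simp: E''_def Eo_def Ei_def El_def dest: E_w)
  have edge_from_special: "(\<exists>y. t = enc p y \<and> (x, y) \<in> E) \<or> t = enc (h p x) w"
    if "(enc p x, t) \<in> E''" "x \<in> P" for p x t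
    using that by (auto simp: E''_def Eo_def Ei_def El_def enc_eq less_imp_le P_w E_w dest: P_w)

  have "\<not> contains_H1 E''"
  proof
    assume "contains_H1 E''"
    then obtain a b c d e where lt: "a < b" "b < c" "c < d" "d < e"
      and ae: "(a, e) \<in> E''" and bd: "(b, d) \<in> E''" and ce: "(c, e) \<in> E''"
      unfolding contains_H1_def by blast
    consider (outer) v where "e = enc v w" | (inner) p y where "e = enc p y" "y < w"
      using edge_end[OF ae] by blast
    then show False
    proof cases
      \<comment> \<open>The vertices \<open>a\<close>, \<open>c\<close>, \<open>e\<close> share a
        copy, hence so does \<open>d\<close>, which lies between \<open>c\<close> and
        \<open>e\<close>, and then \<open>b\<close>. This gives a forbidden pattern in the inner
        graph.\<close>
      case inner
      obtain x where x: "a = enc p x" "(x, y) \<in> E"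
        using edge_to_inner ae inner by blast
      obtain z where z: "c = enc p z" "(z, y) \<in> E"
        using edge_to_inner ce inner by blast
      obtain q t where t: "d = enc q t" "t \<le> w"
        using edge_end[OF bd] less_imp_le by blast
      have "enc p z < enc q t" "enc q t < enc p y"
        using lt t z inner by simp_all
      then have qt: "q = p" "z < t" "t < y"
        using enc_less E_w(2)[OF z(2)] t(2) inner(2) by auto
      then have "t < w" using inner by simp
      then obtain s where s: "b = enc p s" "(s, t) \<in> E"
        using edge_to_inner bd t(1) qt(1) by blast
      have "x < s" "s < z"
        using lt x s z enc_less E_w(2)[OF x(2)] E_w(2)[OF s(2)] E_w(2)[OF z(2)] by auto
      with qt x s z have "contains_H1 E"
        unfolding contains_H1_def by blast
      with i show False by blast
    next
      case outer
      obtain ua xa where a: "a = enc ua xa" "xa \<le> w" "(ua, v) \<in> E'"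
        "xa = w \<or> ua \<in> P' \<and> xa \<in> P \<and> v = h ua xa"
        using edge_to_outer ae outer by blast
      obtain uc xc where c: "c = enc uc xc" "xc \<le> w" "(uc, v) \<in> E'"
        "xc = w \<or> uc \<in> P' \<and> xc \<in> P \<and> v = h uc xc"
        using edge_to_outer ce outer by blast
      consider (douter) vd where "d = enc vd w" | (dinner) p y where "d = enc p y" "y < w"
        using edge_end[OF bd] by blast
      then show False
      proof cases
        \<comment> \<open>Here \<open>c\<close> lies between \<open>b\<close> and \<open>d\<close>,
          so in their copy. As \<open>p\<close> is the first left neighbour of \<open>v\<close>,
          \<open>a\<close> lies there too, but only one vertex of a copy is linked to
          \<open>v\<close>.\<close>
        case dinner
        obtain x where b: "b = enc p x" "(x, y) \<in> E"
          using edge_to_inner bd dinner by blast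
        have "enc p x < enc uc xc" "enc uc xc < enc p y"
          using lt b c dinner by simp_all
        then have uc: "uc = p" "x < xc" "xc < y"
          using enc_less E_w(2)[OF b(2)] c(2) dinner(2) by auto
        then have p: "p \<in> P'" "xc \<in> P" "v = h p xc"
          using c(4) dinner(2) by auto
        have "p \<le> ua" using o p(1) a(3) c(3) uc(1) by blast
        moreover have "enc ua xa < enc p x" using lt a b by simp
        ultimately have ua: "ua = p" "xa < x"
          using enc_less a(2) E_w(2)[OF b(2)] by auto
        then have "xa \<in> P" "v = h p xa" using a(4) uc dinner(2) by auto
        then show False using h_inj p ua uc by force
      next
        case douter
        obtain ub xb where b: "b = enc ub xb" "xb \<le> w" "(ub, vd) \<in> E'"
          "xb = w \<or> ub \<in> P' \<and> xb \<in> P \<and> vd = h ub xb"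
          using edge_to_outer bd douter by blast
        have ab: "ua < ub \<or> ua = ub \<and> xa < xb" using lt(1) a b enc_less by simp
        have bc: "ub < uc \<or> ub = uc \<and> xb < xc" using lt(2) b c enc_less by simp
        have cd: "uc < vd \<or> uc = vd \<and> xc < w" using lt(3) c douter enc_less by simp
        have de: "vd < v" using lt(4) outer douter enc_less by simp
        \<comment> \<open>If \<open>uc = vd\<close>, then \<open>c\<close> lies in the copy before
          \<open>vd\<close>, so \<open>vd\<close> is special and cannot have the left neighbour
          \<open>ub\<close>.\<close>
        have uc_vd: "uc < vd" using cd c(4) b(3) o by auto
        consider "ua < ub" "ub < uc" | "ub = uc" | "ua = ub" "ub < uc"
          using ab bc by auto
        then show False
        proof cases
          case 1
          then have "contains_H1 E'"
            unfolding contains_H1_def using uc_vd de a b c by blast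
          with o show False by blast
        next
          \<comment> \<open>Now \<open>ub\<close> is special and therefore the first left neighbour
            of \<open>v\<close>, so \<open>a\<close> and \<open>b\<close> are in one copy. Links
            preserve order, which contradicts \<open>vd < v\<close>.\<close>
          case 2
          then have p: "xb < xc" "ub \<in> P'" "xb \<in> P" "vd = h ub xb"
            using bc b(4) c(2) by auto
          have "ub \<le> ua" using o p(2) a(3) c(3) 2 by blast
          then have "ua = ub" "xa < xb" using ab by auto
          then have "xa \<in> P" "v = h ub xa" using a(4) p(1) c(2) by auto
          then show False using h_less p de \<open>xa < xb\<close> by force
        next
          \<comment> \<open>This is the splitting of a special vertex into \<open>a\<close> and
            \<open>b\<close> that the last edge condition of \<open>layered\<close>
            excludes.\<close>
          case 3
          then have "ua \<in> P'" using ab a(4) b(2) by auto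
          then have "vd \<le> uc" using o 3 a(3) b(3) c(3) de by blast
          then show False using uc_vd by simp
        qed
      qed
    qed
  qed
  moreover have "\<forall>p\<in>P''. \<forall>a. (a, p) \<notin> E''"
  proof (intro ballI allI notI)
    fix s a assume "s \<in> P''" "(a, s) \<in> E''"
    then obtain p x where "p \<in> P'" "x \<in> P" "s = enc p x" by (auto simp: P''_def)
    with edge_to_inner[of a p x] \<open>(a, s) \<in> E''\<close> P_w i show False by blast
  qed
  moreover have "\<forall>p\<in>P''. card (E'' `` {p}) = Suc m"
  proof
    fix s assume "s \<in> P''"
    then obtain p x where s: "p \<in> P'" "x \<in> P" "s = enc p x" by (auto simp: P''_def)
    have "E'' `` {s} = insert (enc (h p x) w) (enc p ` (E `` {x}))"
    proof (intro equalityI subsetI)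
      fix t assume "t \<in> E'' `` {s}"
      with edge_from_special[of p x t] s show "t \<in> insert (enc (h p x) w) (enc p ` (E `` {x}))"
        by auto
    next
      fix t assume "t \<in> insert (enc (h p x) w) (enc p ` (E `` {x}))"
      then show "t \<in> E'' `` {s}"
        using s by (fastforce simp: E''_def Ei_def El_def image_iff)
    qed
    moreover have "enc (h p x) w \<notin> enc p ` (E `` {x})"
      by (auto simp: enc_eq less_imp_le dest: E_w)
    moreover have "card (enc p ` (E `` {x})) = m"
      using i s by (subst card_image) (auto simp: inj_on_def enc_def)
    ultimately show "card (E'' `` {s}) = Suc m"
      using fin by (simp add: finite_Image)
  qed
  moreover have "\<forall>p a e. p \<in> P'' \<and> (p, e) \<in> E'' \<and> (a, e) \<in> E'' \<longrightarrow> p \<le> a"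
  proof (intro allI impI, elim conjE)
    fix s a e assume "s \<in> P''" and se: "(s, e) \<in> E''" and ae: "(a, e) \<in> E''"
    then obtain p x where s: "p \<in> P'" "x \<in> P" "s = enc p x" by (auto simp: P''_def)
    consider (inner) y where "e = enc p y" "(x, y) \<in> E" | (outer) "e = enc (h p x) w"
      using edge_from_special se s by blast
    then show "s \<le> a"
    proof cases
      case inner
      then obtain x' where "a = enc p x'" "(x', y) \<in> E"
        using edge_to_inner ae E_w(3) by blast
      moreover from this have "x \<le> x'" using i s(2) inner(2) by blast
      ultimately show ?thesis using s(3) by (simp add: enc_def)
    next
      \<comment> \<open>In the outer graph \<open>p\<close> is the first left neighbour of
        \<open>h p x\<close>, and injectivity of \<open>h p\<close> leaves \<open>x\<close> as the
        only vertex of its copy linked there.\<close>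
      case outer
      then obtain u x' where a: "a = enc u x'" "x' \<le> w" "(u, h p x) \<in> E'"
        "x' = w \<or> u \<in> P' \<and> x' \<in> P \<and> h p x = h u x'"
        using edge_to_outer ae by blast
      have "p \<le> u" using o s h_edge a(3) by blast
      moreover have "x \<le> x'" if "u = p" using a(4) that P_w[OF s(2)] h_inj s by auto
      ultimately have "\<not> enc u x' < enc p x"
        using enc_less[of x' x u p] a(2) P_w[OF s(2)] by auto
      then show ?thesis using s a by simp
    qed
  qed
  moreover have "\<forall>p c d e. p \<in> P'' \<and> (p, d) \<in> E'' \<and> (p, e) \<in> E'' \<and> (c, e) \<in> E'' \<and> d < e \<and> p < c
      \<longrightarrow> d \<le> c"
  proof (intro allI impI, elim conjE)
    fix s c d e
    assume "s \<in> P''" and sd: "(s, d) \<in> E''" and se: "(s, e) \<in> E''" and ce: "(c, e) \<in> E''"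
      and de: "d < e" and sc: "s < c"
    then obtain p x where s: "p \<in> P'" "x \<in> P" "s = enc p x" by (auto simp: P''_def)
    consider (inner) y where "e = enc p y" "(x, y) \<in> E" | (outer) "e = enc (h p x) w"
      using edge_from_special se s by blast
    then show "d \<le> c"
    proof cases
      case inner
      then obtain z where z: "c = enc p z" "(z, y) \<in> E"
        using edge_to_inner ce E_w(3) by blast
      have "p < h p x" using E'_less(1) h_edge s by blast
      then have "d \<noteq> enc (h p x) w"
        using de inner enc_less[of w y "h p x" p] E_w(3)[OF inner(2)] by auto
      then obtain t where t: "d = enc p t" "(x, t) \<in> E"
        using edge_from_special sd s by blast
      have "t < y" "x < z" using de sc inner t s z by (simp_all add: enc_def)
      then have "t \<le> z" using i s(2) t(2) inner(2) z(2) by blast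
      then show ?thesis using t z by (simp add: enc_def)
    next
      \<comment> \<open>Since \<open>d < e\<close>, \<open>d\<close> lies in the copy. No other
        vertex of the copy is linked to \<open>h p x\<close>, so \<open>c\<close> comes after the
        whole copy.\<close>
      case outer
      then obtain u x' where c: "c = enc u x'" "x' \<le> w" "(u, h p x) \<in> E'"
        "x' = w \<or> u \<in> P' \<and> x' \<in> P \<and> h p x = h u x'"
        using edge_to_outer ce by blast
      obtain t where t: "d = enc p t" "(x, t) \<in> E"
        using edge_from_special sd s outer de by blast
      have "p < u \<or> p = u \<and> x < x'"
        using sc s c enc_less P_w[OF s(2)] by simp
      then have "p < u \<or> p = u \<and> x' = w"
        using c(4) h_inj s by auto
      then have "enc p t < enc u x'"
        using enc_less c(2) E_w(3)[OF t(2)] by auto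
      then show ?thesis using c t by simp
    qed
  qed
  moreover have "E'' \<subseteq> {(i, j). i \<in> Vo \<union> Vi \<and> j \<in> Vo \<union> Vi \<and> i < j}"
  proof -
    have "Eo \<subseteq> {(i, j). i \<in> Vo \<union> Vi \<and> j \<in> Vo \<union> Vi \<and> i < j}"
      using E'_less by (auto simp: Eo_def Vo_def enc_less)
    moreover have "Ei \<subseteq> {(i, j). i \<in> Vo \<union> Vi \<and> j \<in> Vo \<union> Vi \<and> i < j}"
      using i by (auto simp: Ei_def Vi_def enc_def image_iff)
    moreover have "El \<subseteq> {(i, j). i \<in> Vo \<union> Vi \<and> j \<in> Vo \<union> Vi \<and> i < j}"
    proof
      fix st assume "st \<in> El"
      then obtain p x where st: "p \<in> P'" "x \<in> P" "st = (enc p x, enc (h p x) w)"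
        by (auto simp: El_def)
      have "enc p x \<in> Vi" using st i by (auto simp: Vi_def)
      moreover have "enc (h p x) w \<in> Vo" using E'_less(3)[OF h_edge[OF st(1,2)]] by (simp add: Vo_def)
      moreover have "enc p x < enc (h p x) w"
        using enc_less P_w[OF st(2)] E'_less(1)[OF h_edge[OF st(1,2)]] by simp
      ultimately show "st \<in> {(i, j). i \<in> Vo \<union> Vi \<and> j \<in> Vo \<union> Vi \<and> i < j}"
        using st by simp
    qed
    ultimately show ?thesis by (auto simp: E''_def)
  qed
  moreover have "finite (Vo \<union> Vi)" using fin by (simp add: Vo_def Vi_def)
  moreover have "P'' \<subseteq> Vo \<union> Vi" using i by (auto simp: P''_def Vi_def)
  moreover have "card E'' = Suc k * Suc m * card P''"
  proof -
    have "card E = Suc k * m * card P" "card E' = k * card P * card P'" using i o by auto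
    then show ?thesis by (simp add: card_E'' card_P'' algebra_simps)
  qed
  \<comment> \<open>The slack of 2 in each of the \<open>card P'\<close> copies cancels the term
    \<open>2 * card P'\<close> of the outer bound.\<close>
  moreover have "card (Vo \<union> Vi) + 2 \<le> (Suc m + 2) * card P''"
  proof -
    have "card V + 2 \<le> (m + 2) * card P" and V': "card V' + 2 \<le> (card P + 2) * card P'"
      using i o by auto
    then have "card P' * (card V + 2) \<le> card P' * ((m + 2) * card P)" by (intro mult_le_mono2)
    with V' show ?thesis by (simp add: card_V'' card_P'' algebra_simps)
  qed
  ultimately have "layered (Suc k) (Suc m) (Vo \<union> Vi) P'' E''"
    unfolding layered_def by blast
  then show ?thesis using card_P'' by blast
qed

text \<open>The induction rule of \<open>special_count\<close> supplies exactly the inner and outer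
  graphs that a substitution combines.\<close>

lemma layered_exists: "\<exists>V P E. layered (Suc k) m V P E \<and> card P = special_count k m"
proof (induction k m rule: special_count.induct)
  case (1 m)
  show ?case using layered_two_stars by simp
next
  case (2 k)
  show ?case using layered_no_edges by simp
next
  case (3 k m)
  then show ?case using layered_substitute by (metis special_count.simps(3))
qed

section \<open>The lower bound\<close>

text \<open>The encoding leaves gaps between vertex numbers. An increasing relabelling closes them,
  and forbidden patterns pull back along it.\<close>

lemma H1_free_compress:
  assumes "finite V" "E \<subseteq> {(i, j). i \<in> V \<and> j \<in> V \<and> i < j}" "\<not> contains_H1 E"
  shows "\<exists>F. ordered_graph (card V) F \<and> \<not> contains_H1 F \<and> card F = card E"
proof -
  obtain h where h: "bij_betw h V {..<card V}" "strict_mono_on V h"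
    using ex_strict_mono_bij[of V "{..<card V}"] assms(1) by auto
  define F where "F = map_prod h h ` E"
  have E: "x \<in> V" "y \<in> V" "x < y" if "(x, y) \<in> E" for x y using that assms(2) by auto
  have less: "h x < h y \<longleftrightarrow> x < y" if "x \<in> V" "y \<in> V" for x y
    using h(2) that by (meson strict_mono_on_less)
  have inj: "inj_on h V" using h(1) by (simp add: bij_betw_def)
  have "inj_on (map_prod h h) E"
    using E by (auto simp: inj_on_def inj_on_eq_iff[OF inj])
  then have "card F = card E" by (simp add: F_def card_image)
  moreover have "ordered_graph (card V) F"
    using E less bij_betw_apply[OF h(1)] by (auto simp: ordered_graph_def F_def)
  moreover have "\<not> contains_H1 F"
  proof
    assume "contains_H1 F"
    then obtain a b c d e where lt: "a < b" "b < c" "c < d" "d < e"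
      and F: "(a, e) \<in> F" "(b, d) \<in> F" "(c, e) \<in> F"
      unfolding contains_H1_def by blast
    obtain a' e' where a: "a = h a'" "e = h e'" "(a', e') \<in> E" using F(1) by (auto simp: F_def)
    obtain b' d' where b: "b = h b'" "d = h d'" "(b', d') \<in> E" using F(2) by (auto simp: F_def)
    obtain c' e2 where c: "c = h c'" "e = h e2" "(c', e2) \<in> E" using F(3) by (auto simp: F_def)
    have "e2 = e'" using a c E inj_on_eq_iff[OF inj] by metis
    moreover have "a' < b'" "b' < c'" "c' < d'" "d' < e'"
      using lt a b c less E by metis+
    ultimately have "contains_H1 E" unfolding contains_H1_def using a b c by blast
    with assms(3) show False by blast
  qed
  ultimately show ?thesis by blast
qed

text \<open>The copies occupy consecutive blocks. Edges put \<open>a\<close>, \<open>c\<close>,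
  \<open>e\<close> in one block and \<open>b\<close>, \<open>d\<close> in one block;
  \<open>a < b < c\<close> makes the two blocks equal.\<close>

lemma H1_free_copies:
  assumes "ordered_graph v E" "\<not> contains_H1 E" "0 < v"
  shows "\<exists>F. ordered_graph (t * v) F \<and> \<not> contains_H1 F \<and> card F = t * card E"
proof -
  obtain w where w: "v = Suc w" using assms(3) gr0_implies_Suc by blast
  define enc where "enc q r = q * Suc w + r" for q r
  have enc_less: "enc q r < enc q' r' \<longleftrightarrow> q < q' \<or> q = q' \<and> r < r'"
    if "r \<le> w" "r' \<le> w" for q r q' r'
    unfolding enc_def by (rule lex_code_less_iff[OF that])
  have enc_eq: "enc q r = enc q' r' \<longleftrightarrow> q = q' \<and> r = r'" if "r \<le> w" "r' \<le> w" for q r q' r'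
    unfolding enc_def by (rule lex_code_eq_iff[OF that])
  have E: "x < y" "x \<le> w" "y \<le> w" if "(x, y) \<in> E" for x y
    using that assms(1) by (auto simp: ordered_graph_def w)
  define F where "F = (\<lambda>(q, x, y). (enc q x, enc q y)) ` ({..<t} \<times> E)"
  have "card F = t * card E"
    unfolding F_def
    by (subst card_image) (auto simp: inj_on_def enc_eq E card_cartesian_product)
  moreover have "ordered_graph (t * v) F"
  proof -
    have "enc q y < t * v" if "q < t" "y \<le> w" for q y
      using enc_less[of y 0 q t] that by (simp add: enc_def w)
    then show ?thesis using E by (auto simp: ordered_graph_def F_def enc_less)
  qed
  moreover have "\<not> contains_H1 F"
  proof
    assume "contains_H1 F"
    then obtain a b c d e where lt: "a < b" "b < c" "c < d" "d < e"
      and F: "(a, e) \<in> F" "(b, d) \<in> F" "(c, e) \<in> F"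
      unfolding contains_H1_def by blast
    obtain q a' e' where a: "a = enc q a'" "e = enc q e'" "(a', e') \<in> E"
      using F(1) by (auto simp: F_def)
    obtain r b' d' where b: "b = enc r b'" "d = enc r d'" "(b', d') \<in> E"
      using F(2) by (auto simp: F_def)
    obtain q' c' e2 where c: "c = enc q' c'" "e = enc q' e2" "(c', e2) \<in> E"
      using F(3) by (auto simp: F_def)
    have eq: "q' = q" "e2 = e'" using a c E enc_eq by metis+
    have "a' < b' \<and> r = q \<or> q < r" "b' < c' \<and> r = q \<or> r < q" "c' < d' \<and> r = q \<or> q < r"
      "d' < e' \<and> r = q \<or> r < q"
      using lt enc_less E(2,3)[OF a(3)] E(2,3)[OF b(3)] E(2,3)[OF c(3)]
      unfolding a(1) b(1,2) c(1) eq by (auto simp: a(2))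
    then have "a' < b'" "b' < c'" "c' < d'" "d' < e'" by auto
    then have "contains_H1 E" unfolding contains_H1_def using a b c eq by blast
    with assms(2) show False by blast
  qed
  ultimately show ?thesis by blast
qed

text \<open>All edges leave 0, whereas the pattern has distinct left ends. This settles bounded
  values of \<open>inv_ack\<close>.\<close>

lemma H1_free_star: "\<exists>E. ordered_graph n E \<and> \<not> contains_H1 E \<and> card E = n - 1"
proof (intro exI conjI)
  show "card (Pair (0::nat) ` {1..<n}) = n - 1" by (simp add: card_image inj_on_def)
qed (auto simp: ordered_graph_def contains_H1_def)

text \<open>As many copies as fit are placed side by side. The 6 is a factor 3 from
  \<open>v \<le> 3 * s\<close> times a factor 2 from rounding \<open>n\<close> down to a multiple of
  \<open>v\<close>.\<close>

lemma H1_free_level: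
  assumes "3 * special_count k 1 \<le> n"
  shows "\<exists>E. ordered_graph n E \<and> \<not> contains_H1 E \<and> n * Suc k \<le> 6 * card E"
proof -
  define s where "s = special_count k 1"
  obtain V P E where l: "layered (Suc k) 1 V P E" and P: "card P = s"
    using layered_exists s_def by metis
  define v where "v = card V"
  have v: "v \<le> 3 * s" and card_E: "card E = Suc k * s" and "finite V" "P \<subseteq> V"
    using l P by (auto simp: layered_def v_def)
  then have "s \<le> v" using P card_mono by (auto simp: v_def)
  then have "0 < v" using special_count_pos[of k 1] by (simp add: s_def)
  obtain F where F: "ordered_graph v F" "\<not> contains_H1 F" "card F = card E"
    using H1_free_compress[of V E] l by (auto simp: layered_def v_def)
  define t where "t = n div v"
  obtain G where G: "ordered_graph (t * v) G" "\<not> contains_H1 G" "card G = t * card F"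
    using H1_free_copies[OF F(1,2) \<open>0 < v\<close>] by blast
  have tv: "t * v \<le> n" by (simp add: t_def)
  then have "ordered_graph n G" using G(1) by (auto simp: ordered_graph_def)
  moreover have "n * Suc k \<le> 6 * card G"
  proof -
    have "v \<le> n" using v assms by (simp add: s_def)
    then have "1 \<le> t" using \<open>0 < v\<close> by (simp add: t_def div_greater_zero_iff Suc_le_eq)
    have "n = t * v + n mod v" by (simp add: t_def)
    also have "\<dots> \<le> t * v + v" using \<open>0 < v\<close> by (simp add: less_imp_le)
    also have "\<dots> \<le> 2 * (t * v)" using \<open>1 \<le> t\<close> by simp
    also have "\<dots> \<le> 2 * (t * (3 * s))" using v by simp
    finally have "n * Suc k \<le> 2 * (t * (3 * s)) * Suc k" by (rule mult_le_mono1)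
    then show ?thesis by (simp add: G(3) F(3) card_E algebra_simps)
  qed
  ultimately show ?thesis using G(2) by blast
qed

theorem theorem3p7:
  shows "\<exists>c::real. c > 0 \<and> (\<forall>n::nat. n > 0 \<longrightarrow>
     (\<exists>E. ordered_graph n E \<and> \<not> contains_H1 E \<and>
          real (card E) \<ge> c * real n * real (inv_ack n)))"
proof (intro exI[of _ "1 / 36 :: real"] conjI allI impI)
  fix n :: nat
  assume "n > 0"
  define K where "K = inv_ack n"
  \<comment> \<open>The 36 is the 6 of \<open>H1_free_level\<close> times the 6 in
    \<open>K \<le> 6 * Suc k\<close>.\<close>
  have "\<exists>E. ordered_graph n E \<and> \<not> contains_H1 E \<and> n * K \<le> 36 * card E"
  proof (cases "K < 5")
    case True
    obtain E where E: "ordered_graph n E" "\<not> contains_H1 E" "card E = n - 1"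
      using H1_free_star by blast
    have "n * K \<le> 36 * (n - 1)"
    \<comment> \<open>For \<open>n = 1\<close> the star has no edge, but \<open>ack 0 0 = 1\<close>
      gives \<open>K = 0\<close>.\<close>
    proof (cases "n = 1")
      case True
      then have "K = 0" unfolding K_def inv_ack_def by (intro Least_equality) auto
      then show ?thesis by simp
    next
      case False
      have "n * K \<le> n * 4" using True by (intro mult_le_mono2) simp
      with False \<open>n > 0\<close> show ?thesis by linarith
    qed
    with E show ?thesis by auto
  next
    case False
    \<comment> \<open>This is the largest \<open>k\<close> with
      \<open>2 * k + 4 \<le> K - 1\<close>. Minimality of \<open>K\<close> puts the diagonal value
      at \<open>K - 1\<close> below \<open>n\<close>, so the graph of level \<open>Suc k\<close>
      fits.\<close>
    define k where "k = (K - 5) div 2"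
    have "K - 1 < K" using False by simp
    then have not_le: "\<not> n \<le> ack (K - 1) (K - 1)"
      unfolding K_def inv_ack_def by (rule not_less_Least)
    have k: "2 * k + 4 \<le> K - 1" "K \<le> 6 * Suc k" using False by (auto simp: k_def)
    have "ack (2 * k + 4) (2 * k + 4) \<le> ack (K - 1) (2 * k + 4)" using k(1) by (rule ack_mono_left)
    also have "\<dots> \<le> ack (K - 1) (K - 1)" using k(1) by (rule ack_mono)
    finally have "3 * special_count k 1 \<le> ack (K - 1) (K - 1)"
      using triple_special_count_le_ack[of k] by (rule order_trans[rotated])
    with not_le have "3 * special_count k 1 \<le> n" by linarith
    from H1_free_level[OF this] obtain E
      where E: "ordered_graph n E" "\<not> contains_H1 E" "n * Suc k \<le> 6 * card E" by blast
    have "n * K \<le> n * (6 * Suc k)" using k(2) by (rule mult_le_mono2)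
    with E(3) have "n * K \<le> 36 * card E" by (simp add: algebra_simps)
    with E show ?thesis by blast
  qed
  then obtain E where E: "ordered_graph n E" "\<not> contains_H1 E" "n * K \<le> 36 * card E"
    by blast
  have "real n * real K \<le> 36 * real (card E)"
    using E(3) by (metis of_nat_le_iff of_nat_mult of_nat_numeral)
  with E(1,2) show "\<exists>E. ordered_graph n E \<and> \<not> contains_H1 E \<and>
      real (card E) \<ge> 1 / 36 * real n * real (inv_ack n)"
    by (auto simp: K_def)
qed simp

end
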